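(* Let $n \ge 2$ be an integer. Let $X$ be a random variable taking values in $\{1,\ldots,n-1\}$ with distribution $$P(X=k)=\frac{1}{\binom{n}{2}}\,\frac{3\cdot 5\cdots(2k-1)}{2\cdot 4\cdots(2k-2)}\,\frac{3\cdot 5\cdots(2(n-k)-1)}{2\cdot 4\cdots(2(n-k)-2)},\qquad 1\le k\le n-1,$$ and let $S$ be a random variable having the semicircle distribution, that is, with density $\frac{2}{\pi}\sqrt{1-s^2}$ for $s\in(-1,1)$ (and $0$ elsewhere). Then $$\frac{1}{16n}\le d_W\left(\frac{2X}{n}-1,\,S\right)\le \frac{59}{n},$$ where $d_W$ denotes the Wasserstein distance.
   Context: Empty products equal $1$; explicitly, $P(X=k)=\frac{1}{\binom{n}{2}}\frac{\prod_{j=1}^{k-1}(2j+1)}{\prod_{j=1}^{k-1}2j}\cdot\frac{\prod_{j=1}^{n-k-1}(2j+1)}{\prod_{j=1}^{n-k-1}2j}$ for $1\le k\le n-1$. The Wasserstein distance between (the laws of) two real random variables $U$ and $V$ is $$d_W(U,V)=\sup_{h\in\mathcal{L}_1}|E h(U)-E h(V)|,$$ where $\mathcal{L}_1$ is the collection of all functions $h:\mathbb{R}\to\mathbb{R}$ with $|h(x)-h(y)|\le|x-y|$ for all real $x,y$. Equivalently, $d_W(U,V)$ is the infimum of $E|U-V|$ over all joint distributions of $(U,V)$ with the given marginals. Background: it is known that this distribution of $X$ is that of the location $s_1$ of the first adjacent transposition in a uniformly random reduced decomposition $s_1,\ldots,s_{\binom{n}{2}}$ of the longest element $n\ (n-1)\cdots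 2\ 1$ of the symmetric group $S_n$, i.e. a sequence with $\tau_{s_1}\tau_{s_2}\cdots\tau_{s_{\binom n2}}$ equal to the longest element, where $\tau_s=(s\ \ s+1)$. The claim itself concerns only $X$ with the explicit distribution above. *)

theory Defs
  imports "HOL-Probability.Probability"
begin

definition first_swap_prob :: "nat \<Rightarrow> nat \<Rightarrow> real" where
  "first_swap_prob n k =
     1 / real (n choose 2)
     * ((\<Prod>j = 1..k - 1. real (2 * j + 1)) / (\<Prod>j = 1..k - 1. real (2 * j)))
     * ((\<Prod>j = 1..n - k - 1. real (2 * j + 1)) / (\<Prod>j = 1..n - k - 1. real (2 * j)))"

definition semicircle_density :: "real \<Rightarrow> real" where
  "semicircle_density s = (if - 1 < s \<and> s < 1 then 2 / pi * sqrt (1 - s\<^sup>2) else 0)"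

(* The supremum is taken in ereal, so that it is never an unspecified real supremum of an
   unbounded set. The expectations are Bochner integrals, which are 0 for non-integrable
   functions, so the definition is meaningful only for U and V with finite first moment
   (in particular for bounded ones). *)
definition wasserstein_dist ::
  "'a measure \<Rightarrow> ('a \<Rightarrow> real) \<Rightarrow> 'b measure \<Rightarrow> ('b \<Rightarrow> real) \<Rightarrow> ereal" where
  "wasserstein_dist M U N V =
     (SUP h \<in> {h :: real \<Rightarrow> real. 1-lipschitz_on UNIV h}.
        ereal \<bar>(\<integral>x. h (U x) \<partial>M) - (\<integral>y. h (V y) \<partial>N)\<bar>)"

end

theory Submission
  imports Defs
begin

text \<open>Write \<open>x k = 2k/n - 1\<close> and let \<open>f\<close> be the semicircle density. The Wallis product and monotonicity
  give \<open>\<Prod>j\<le>m. (2j+1)/(2j) \<le> sqrt (4 (m+1) / \<pi>)\<close>, so that \<open>P(X = k) \<le> n/(n-1) r k\<close> with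
  \<open>r k = 2/n f (x k)\<close>. As \<open>f\<close> has bounded variation, the Riemann sums \<open>\<Sum> r k\<close> and \<open>\<Sum> r k h (x k)\<close>
  differ from \<open>1\<close> and \<open>E h(S)\<close> by \<open>O(1/n)\<close>. Since \<open>\<Sum> P(X = k) = 1\<close>, the one-sided bound on the
  probabilities already forces \<open>\<Sum> \<bar>P(X = k) - r k\<bar> = O(1/n)\<close>, whence the upper bound.
  For the lower bound, take for \<open>h\<close> the distance to the lattice of the \<open>x k\<close>, which vanishes on the
  values of \<open>2X/n - 1\<close> but is of order \<open>1/n\<close> for a bounded density.\<close>

section \<open>Wallis product and an upper bound for the point probabilities\<close>

text \<open>The square of the product \<open>a m\<close> times the \<open>m\<close>-th partial
  Wallis product is exactly 2m+1. Hence \<open>(a m)\<^sup>2 / (m + 1)\<close> tends to 2 / (pi/2) =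
  4/pi, and since this sequence increases, it never exceeds its limit.\<close>

lemma wallis_ratio_square_le:
  "(\<Prod>j=1..m. real (2*j+1) / real (2*j))\<^sup>2 \<le> 4 / pi * (real m + 1)"
proof -
  define a where "a = (\<lambda>m::nat. \<Prod>j=1..m. real (2*j+1) / real (2*j))"
  define W where "W = (\<lambda>m::nat. \<Prod>k=1..m. (4 * real k^2) / (4 * real k^2 - 1))"
  have W: "W \<longlonglongrightarrow> pi / 2"
    using wallis unfolding W_def .
  have aSuc: "a (Suc m) = a m * ((2 * real m + 3) / (2 * real m + 2))" for m
    unfolding a_def by (simp add: algebra_simps)
  have WSuc: "W (Suc m) = W m * ((2 * real m + 2)^2 / ((2 * real m + 1) * (2 * real m + 3)))" for m
    unfolding W_def by (simp add: algebra_simps power2_eq_square)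
  have aW: "(a m)\<^sup>2 * W m = 2 * real m + 1" for m
  proof (induction m)
    case 0
    then show ?case by (simp add: a_def W_def)
  next
    case (Suc m)
    have "(a (Suc m))\<^sup>2 * W (Suc m) = ((a m)\<^sup>2 * W m) *
      (((2 * real m + 3) / (2 * real m + 2))\<^sup>2 * ((2 * real m + 2)^2 / ((2 * real m + 1) * (2 * real m + 3))))"
      unfolding aSuc WSuc power_mult_distrib by (simp only: ac_simps)
    also have "((2 * real m + 3) / (2 * real m + 2))\<^sup>2 * ((2 * real m + 2)^2 / ((2 * real m + 1) * (2 * real m + 3)))
      = (2 * real m + 3) / (2 * real m + 1)"
      by (simp add: divide_simps power2_eq_square add_pos_nonneg add_nonneg_eq_0_iff)
    finally show ?case
      using Suc by (simp add: divide_simps add_pos_nonneg add_nonneg_eq_0_iff)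
  qed
  define b where "b = (\<lambda>m. (a m)\<^sup>2 / (real m + 1))"
  have "incseq b"
  proof (rule incseq_SucI)
    fix m
    \<comment> \<open>With denominators cleared this is 4(m+1)(m+2) \<le> (2m+3)^2, whose sides
      differ by exactly 1.\<close>
    have "1 / (real m + 1) \<le> ((2 * real m + 3) / (2 * real m + 2))\<^sup>2 / (real m + 2)"
      by (simp add: divide_simps power2_eq_square add_pos_nonneg add_nonneg_eq_0_iff)
        (simp add: algebra_simps)
    then have "(a m)\<^sup>2 * (1 / (real m + 1)) \<le> (a m)\<^sup>2 * (((2 * real m + 3) / (2 * real m + 2))\<^sup>2 / (real m + 2))"
      by (intro mult_left_mono) auto
    then show "b m \<le> b (Suc m)"
      unfolding b_def aSuc power_mult_distrib by (simp add: add.commute)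
  qed
  moreover have "b \<longlonglongrightarrow> 4 / pi"
  proof -
    have Wpos: "W m > 0" for m
    proof -
      have "0 < (a m)\<^sup>2 * W m" unfolding aW by simp
      then show ?thesis by (simp add: zero_less_mult_iff)
    qed
    have "b = (\<lambda>m. ((2 * real m + 1) / (real m + 1)) / W m)"
    proof
      fix m
      have "(a m)\<^sup>2 = (2 * real m + 1) / W m"
        using aW[of m] Wpos[of m] by (simp add: field_simps)
      then show "b m = ((2 * real m + 1) / (real m + 1)) / W m"
        by (simp add: b_def)
    qed
    moreover have "(\<lambda>m. (2 * real m + 1) / (real m + 1)) \<longlonglongrightarrow> 2"
      by real_asymp
    from tendsto_divide[OF this W] have "(\<lambda>m. ((2 * real m + 1) / (real m + 1)) / W m) \<longlonglongrightarrow> 4 / pi"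
      by simp
    ultimately show ?thesis by simp
  qed
  ultimately have "b m \<le> 4 / pi"
    by (rule incseq_le)
  then show ?thesis
    by (simp add: b_def a_def pos_divide_le_eq)
qed

text \<open>The two products have m = k-1 and m = n-k-1 factors, so the quantity m+1 in the Wallis
  bound becomes k and n-k respectively.\<close>

lemma first_swap_prob_le:
  assumes "1 \<le> k" "k \<le> n - 1"
  shows "first_swap_prob n k \<le> 8 / (pi * real n * (real n - 1)) * sqrt (real k * (real n - real k))"
proof -
  define a where "a = (\<lambda>m::nat. \<Prod>j=1..m. real (2*j+1) / real (2*j))"
  have le: "a m \<le> sqrt (4 / pi * (real m + 1))" for m
    using wallis_ratio_square_le[of m] unfolding a_def by (rule real_le_rsqrt)
  have nn: "0 \<le> a m" for m
    unfolding a_def by (intro prod_nonneg) auto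
  have n: "n \<ge> 2" "k < n" using assms by auto
  have ch: "real (n choose 2) = real n * (real n - 1) / 2"
    using n by (simp add: choose_two real_of_nat_div of_nat_diff)
  have "a (k - 1) * a (n - k - 1) \<le> sqrt (4 / pi * (real (k - 1) + 1)) * sqrt (4 / pi * (real (n - k - 1) + 1))"
    by (intro mult_mono le nn) auto
  also have "\<dots> = sqrt (4 / pi * real k) * sqrt (4 / pi * (real n - real k))"
    using assms n by (simp add: of_nat_diff)
  also have "\<dots> = 4 / pi * sqrt (real k * (real n - real k))"
    by (simp only: real_sqrt_mult mult_ac real_sqrt_mult_self) simp
  finally have *: "a (k - 1) * a (n - k - 1) \<le> 4 / pi * sqrt (real k * (real n - real k))" .
  have "first_swap_prob n k = 2 / (real n * (real n - 1)) * (a (k - 1) * a (n - k - 1))"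
    unfolding first_swap_prob_def a_def ch by (simp only: prod_dividef) simp
  also have "\<dots> \<le> 2 / (real n * (real n - 1)) * (4 / pi * sqrt (real k * (real n - real k)))"
    using * n by (intro mult_left_mono) auto
  finally show ?thesis by (simp add: field_simps)
qed

section \<open>Riemann sums and bounded variation\<close>

text \<open>The hypothesis says that the increments of the monotone function \<open>G\<close> dominate the
  variation of \<open>F\<close>.\<close>
lemma riemann_sum_error_le:
  fixes F G :: "real \<Rightarrow> real"
  assumes ab: "a \<le> b" and n: "n > 0" and cont: "continuous_on {a..b} F"
    and G: "\<And>x y. a \<le> x \<Longrightarrow> x \<le> y \<Longrightarrow> y \<le> b \<Longrightarrow> \<bar>F y - F x\<bar> \<le> G y - G x"
  shows "\<bar>(\<Sum>k<n. (b - a) / real n * F (a + real k * ((b - a) / real n))) - integral {a..b} F\<bar>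
    \<le> (b - a) / real n * (G b - G a)"
proof -
  define w where "w = (b - a) / real n"
  have w: "w \<ge> 0" using ab by (simp add: w_def)
  have nw: "a + real n * w = b" using n by (simp add: w_def)
  have xb: "a + real k * w \<le> b" if "k \<le> n" for k
    using that w nw mult_right_mono[of "real k" "real n" w] by simp
  \<comment> \<open>Induction on the number \<open>m\<close> of cells covered, with the mesh
    \<open>w\<close> fixed: each cell adds an error of at most \<open>w\<close> times the increment
    of \<open>G\<close>, and these increments telescope.\<close>
  have "m \<le> n \<Longrightarrow> \<bar>(\<Sum>k<m. w * F (a + real k * w)) - integral {a..a + real m * w} F\<bar>
    \<le> w * (G (a + real m * w) - G a)" for m
  proof (induction m)
    case 0
    then show ?case by simp
  next
    case (Suc m)
    define x where "x = a + real m * w"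
    define y where "y = a + real (Suc m) * w"
    have xy: "a \<le> x" "x \<le> y" "y \<le> b" "y - x = w"
      using w xb[OF Suc.prems] by (auto simp: x_def y_def algebra_simps)
    have int: "F integrable_on {u..v}" if "a \<le> u" "v \<le> b" for u v
      using cont that by (intro integrable_continuous_real continuous_on_subset[OF cont]) auto
    have split: "integral {a..y} F = integral {a..x} F + integral {x..y} F"
      using xy int by (intro Henstock_Kurzweil_Integration.integral_combine[symmetric]) auto
    have "((\<lambda>s. F x - F s) has_integral (w * F x - integral {x..y} F)) {x..y}"
      using xy has_integral_const_real[of "F x" x y]
      by (intro has_integral_diff integrable_integral int) auto
    then have "norm (w * F x - integral {x..y} F) \<le> (G y - G x) * measure lborel {x..y}"
    proof (rule has_integral_bound_real[rotated 2])
      show "0 \<le> G y - G x" using G[of x y] xy by linarith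
      show "finite ({} :: real set)" by simp
      \<comment> \<open>The increments of \<open>G\<close> from \<open>x\<close> to \<open>s\<close>
        and from \<open>s\<close> to \<open>y\<close> are nonnegative, so the first one is at most
        \<open>G y - G x\<close>.\<close>
      fix s assume s: "s \<in> {x..y} - {}"
      then show "norm (F x - F s) \<le> G y - G x"
        using G[of x s] G[of s y] xy by auto
    qed
    then have "\<bar>w * F x - integral {x..y} F\<bar> \<le> w * (G y - G x)"
      using xy by (simp add: mult.commute)
    moreover have "\<bar>(\<Sum>k<m. w * F (a + real k * w)) - integral {a..x} F\<bar> \<le> w * (G x - G a)"
      using Suc unfolding x_def by simp
    ultimately have "\<bar>(\<Sum>k<m. w * F (a + real k * w)) + w * F x - integral {a..y} F\<bar> \<le> w * (G y - G a)"
      unfolding split by (simp add: right_diff_distrib)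
    then show ?case by (simp add: x_def y_def)
  qed
  from this[of n] show ?thesis unfolding nw by (simp add: w_def)
qed

section \<open>The semicircle density, its variation and its Riemann sums\<close>

text \<open>At the endpoints the square root vanishes and agrees with the default value 0;
  continuity on the closed interval follows from this.\<close>

lemma semicircle_density_eq_sqrt:
  "\<bar>s\<bar> \<le> 1 \<Longrightarrow> semicircle_density s = 2 / pi * sqrt (1 - s\<^sup>2)"
  by (cases "s = 1 \<or> s = -1") (auto simp: semicircle_density_def)

lemma continuous_on_semicircle_density: "continuous_on {-1..1} semicircle_density"
proof -
  have "continuous_on {-1..1} (\<lambda>s::real. 2 / pi * sqrt (1 - s\<^sup>2))"
    by (intro continuous_intros)
  then show ?thesis
    by (subst continuous_on_cong[OF refl semicircle_density_eq_sqrt]) auto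
qed

lemma semicircle_density_nonneg: "semicircle_density s \<ge> 0"
  by (auto simp: semicircle_density_def abs_square_le_1 intro!: mult_nonneg_nonneg)

lemma semicircle_density_le: "semicircle_density s \<le> 2 / pi"
  by (auto simp: semicircle_density_def divide_right_mono)

text \<open>The density increases on \<open>[-1, 0]\<close> up to its maximum \<open>2 / \<pi>\<close> and decreases afterwards.\<close>
definition semicircle_variation :: "real \<Rightarrow> real" where
  "semicircle_variation s = (if s \<le> 0 then semicircle_density s else 4 / pi - semicircle_density s)"

lemma semicircle_density_variation_le:
  assumes "-1 \<le> x" "x \<le> y" "y \<le> 1"
  shows "\<bar>semicircle_density y - semicircle_density x\<bar> \<le> semicircle_variation y - semicircle_variation x"
proof -
  have anti: "semicircle_density v \<le> semicircle_density u" if "\<bar>u\<bar> \<le> \<bar>v\<bar>" "\<bar>v\<bar> \<le> 1" for u v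
  proof -
    have "u\<^sup>2 \<le> v\<^sup>2" using that(1) by (simp add: abs_le_square_iff)
    then show ?thesis using that by (simp add: semicircle_density_eq_sqrt divide_right_mono)
  qed
  consider "y \<le> 0" | "x \<le> 0" "0 < y" | "0 < x" using assms by linarith
  then show ?thesis
  proof cases
    case 1
    then show ?thesis using anti[of y x] assms by (simp add: semicircle_variation_def)
  next
    \<comment> \<open>The maximum at 0 separates the two points. With f the density, the right-hand
      side is (2/pi - f x) + (2/pi - f y), a sum of nonnegative terms whose difference is, up to
      sign, f y - f x.\<close>
    case 2
    then show ?thesis using semicircle_density_le[of x] semicircle_density_le[of y]
      by (simp add: semicircle_variation_def abs_le_iff)
  next
    case 3
    then show ?thesis using anti[of x y] assms by (simp add: semicircle_variation_def)
  qed
qed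

text \<open>By the product rule for increments, the variation of \<open>h\<close> times the density
  is controlled by \<open>L\<close> times the maximal density 2/pi and by \<open>B\<close> times the
  variation of the density. Over [-1,1] the function \<open>G\<close> grows by 4/pi (L + B); the
  mesh 2/n supplies the remaining factor.\<close>

lemma semicircle_riemann_sum_error_le:
  fixes h :: "real \<Rightarrow> real"
  assumes n: "n > 0" and lip: "L-lipschitz_on {-1..1} h" and B: "\<And>x. \<bar>x\<bar> \<le> 1 \<Longrightarrow> \<bar>h x\<bar> \<le> B"
  shows "\<bar>(\<Sum>k=1..n-1. 2 / real n * (h (2 * real k / real n - 1) * semicircle_density (2 * real k / real n - 1)))
      - integral {-1..1} (\<lambda>s. h s * semicircle_density s)\<bar> \<le> 8 / (pi * real n) * (L + B)"
proof -
  define G where "G = (\<lambda>x. 2 / pi * L * x + B * semicircle_variation x)"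
  define F where "F = (\<lambda>s. h s * semicircle_density s)"
  have "\<bar>F y - F x\<bar> \<le> G y - G x" if "-1 \<le> x" "x \<le> y" "y \<le> 1" for x y
  proof -
    have L0: "L \<ge> 0" using lip by (rule lipschitz_on_nonneg)
    have hd: "\<bar>h y - h x\<bar> \<le> L * (y - x)"
      using lipschitz_onD[OF lip, of y x] that by (simp add: dist_real_def)
    have "\<bar>F y - F x\<bar> = \<bar>(h y - h x) * semicircle_density y + h x * (semicircle_density y - semicircle_density x)\<bar>"
      by (simp add: F_def algebra_simps)
    also have "\<dots> \<le> \<bar>h y - h x\<bar> * semicircle_density y + \<bar>h x\<bar> * \<bar>semicircle_density y - semicircle_density x\<bar>"
      using semicircle_density_nonneg[of y] by (intro order.trans[OF abs_triangle_ineq]) (simp add: abs_mult)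
    also have "\<dots> \<le> (L * (y - x)) * (2 / pi) + B * (semicircle_variation y - semicircle_variation x)"
      using that B[of x] semicircle_density_variation_le[OF that] hd L0 order.trans[OF abs_ge_zero B[of x]]
      by (intro add_mono mult_mono semicircle_density_le semicircle_density_nonneg) auto
    also have "\<dots> = G y - G x"
      by (simp add: G_def algebra_simps)
    finally show ?thesis .
  qed
  moreover have "continuous_on {-1..1} F"
    unfolding F_def
    by (intro continuous_on_mult continuous_on_semicircle_density lipschitz_on_continuous_on[OF lip])
  ultimately have "\<bar>(\<Sum>k<n. (1 - (-1)) / real n * F (-1 + real k * ((1 - (-1)) / real n))) - integral {-1..1} F\<bar>
    \<le> (1 - (-1)) / real n * (G 1 - G (-1))"
    using n by (intro riemann_sum_error_le) auto
  also have "(1 - (-1)) / real n * (G 1 - G (-1)) = 8 / (pi * real n) * (L + B)"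
    by (simp add: G_def semicircle_variation_def semicircle_density_def field_simps)
  also have "(\<Sum>k<n. (1 - (-1)) / real n * F (-1 + real k * ((1 - (-1)) / real n)))
    = (\<Sum>k<n. 2 / real n * F (2 * real k / real n - 1))"
    by (intro sum.cong) (auto simp: mult.commute)
  \<comment> \<open>The left-endpoint sum also contains k = 0, which sits at -1, where the density
    vanishes.\<close>
  also have "\<dots> = (\<Sum>k=1..n-1. 2 / real n * F (2 * real k / real n - 1))"
  proof (rule sum.mono_neutral_right)
    show "\<forall>i\<in>{..<n} - {1..n - 1}. 2 / real n * F (2 * real i / real n - 1) = 0"
    proof
      fix i assume "i \<in> {..<n} - {1..n - 1}"
      then have "i = 0" by auto
      then show "2 / real n * F (2 * real i / real n - 1) = 0"
        by (simp add: F_def semicircle_density_def)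
    qed
  qed (use n in auto)
  finally show ?thesis unfolding F_def .
qed

section \<open>Expectations as integrals and as finite sums\<close>

text \<open>The density vanishes outside the compact interval [-1,1], on which the product with a
  continuous \<open>h\<close> is integrable. The Lebesgue integral over the line thus becomes a
  gauge integral over [-1,1], the form used for Riemann sums.\<close>

lemma integral_semicircle_distributed:
  fixes h :: "real \<Rightarrow> real"
  assumes D: "distributed N lborel S (\<lambda>s. ennreal (semicircle_density s))"
    and h: "continuous_on UNIV h"
  shows "integrable N (\<lambda>y. h (S y))"
    and "(\<integral>y. h (S y) \<partial>N) = integral {-1..1} (\<lambda>s. h s * semicircle_density s)"
proof -
  have hm [measurable]: "h \<in> borel_measurable borel"
    using h by (rule borel_measurable_continuous_onI)
  have c: "continuous_on {-1..1} (\<lambda>s. h s * semicircle_density s)"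
    by (intro continuous_on_mult continuous_on_semicircle_density continuous_on_subset[OF h]) auto
  have eq: "(\<lambda>s. indicator {-1..1} s *\<^sub>R (h s * semicircle_density s)) = (\<lambda>s. semicircle_density s * h s)"
    by (auto simp: fun_eq_iff indicator_def semicircle_density_def)
  have si: "set_integrable lborel {-1..1} (\<lambda>s. h s * semicircle_density s)"
    using c by (intro borel_integrable_compact[unfolded set_integrable_def[symmetric]]
        borel_integrable_atLeastAtMost') auto
  then have "integrable lborel (\<lambda>s. semicircle_density s * h s)"
    unfolding set_integrable_def eq .
  then show "integrable N (\<lambda>y. h (S y))"
    using distributed_integrable[OF D, of h] semicircle_density_nonneg by simp
  have "(\<integral>y. h (S y) \<partial>N) = (\<integral>s. semicircle_density s * h s \<partial>lborel)"
    using distributed_integral[OF D, of h] semicircle_density_nonneg by simp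
  also have "\<dots> = integral {-1..1} (\<lambda>s. h s * semicircle_density s)"
    using set_borel_integral_eq_integral(2)[OF si] unfolding set_lebesgue_integral_def eq .
  finally show "(\<integral>y. h (S y) \<partial>N) = integral {-1..1} (\<lambda>s. h s * semicircle_density s)" .
qed

lemma (in prob_space) expectation_finite_range:
  fixes g :: "'b \<Rightarrow> real"
  assumes X: "X \<in> measurable M (count_space A)" and A: "finite A"
  shows "expectation (\<lambda>\<omega>. g (X \<omega>)) = (\<Sum>k\<in>A. \<P>(\<omega> in M. X \<omega> = k) * g k)"
proof -
  have ms: "{\<omega> \<in> space M. X \<omega> = k} \<in> events" if "k \<in> A" for k
    using measurable_sets[OF X, of "{k}"] that by (simp add: vimage_def Int_def conj_commute)
  have "expectation (\<lambda>\<omega>. g (X \<omega>)) = expectation (\<lambda>\<omega>. \<Sum>k\<in>A. indicator {\<omega> \<in> space M. X \<omega> = k} \<omega> * g k)"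
  proof (rule Bochner_Integration.integral_cong[OF refl])
    fix \<omega> assume \<omega>: "\<omega> \<in> space M"
    then have "X \<omega> \<in> A" using measurable_space[OF X] by simp
    have "(\<Sum>k\<in>A. indicator {\<omega> \<in> space M. X \<omega> = k} \<omega> * g k) = (\<Sum>k\<in>A. if X \<omega> = k then g k else 0)"
      using \<omega> by (intro sum.cong) (auto simp: indicator_def)
    then show "g (X \<omega>) = (\<Sum>k\<in>A. indicator {\<omega> \<in> space M. X \<omega> = k} \<omega> * g k)"
      using A \<open>X \<omega> \<in> A\<close> by simp
  qed
  also have "\<dots> = (\<Sum>k\<in>A. expectation (\<lambda>\<omega>. indicator {\<omega> \<in> space M. X \<omega> = k} \<omega> * g k))"
    using ms by (intro Bochner_Integration.integral_sum integrable_mult_left integrable_real_indicator)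
      (auto simp: emeasure_eq_measure)
  also have "\<dots> = (\<Sum>k\<in>A. \<P>(\<omega> in M. X \<omega> = k) * g k)"
    using ms by (intro sum.cong) (auto simp: Int_absorb2 sets.sets_into_space)
  finally show ?thesis .
qed

section \<open>Comparing the probabilities with the Riemann weights\<close>

text \<open>Turns a one-sided pointwise bound into an L1 bound, small when both sums are near 1.
  Where p \<ge> r, the termwise estimate is the first hypothesis doubled; where p < r, it follows
  from c r \<ge> 0.\<close>

lemma sum_abs_diff_le:
  fixes p r :: "'a \<Rightarrow> real"
  assumes "\<And>k. k \<in> A \<Longrightarrow> p k \<le> (1 + c) * r k" "\<And>k. k \<in> A \<Longrightarrow> r k \<ge> 0" "c \<ge> 0"
  shows "(\<Sum>k\<in>A. \<bar>p k - r k\<bar>) \<le> (1 + 2 * c) * sum r A - sum p A"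
proof -
  have "(\<Sum>k\<in>A. \<bar>p k - r k\<bar>) \<le> (\<Sum>k\<in>A. (1 + 2 * c) * r k - p k)"
  proof (rule sum_mono)
    fix k assume k: "k \<in> A"
    have "c * r k \<ge> 0" using k assms by simp
    then show "\<bar>p k - r k\<bar> \<le> (1 + 2 * c) * r k - p k"
      using assms(1)[OF k] by (simp add: abs_le_iff algebra_simps)
  qed
  then show ?thesis by (simp add: sum_subtractf sum_distrib_left)
qed

text \<open>At the lattice point x = 2k/n - 1 one has 1 - x^2 = 4k(n-k)/n^2, so the Wallis bound is
  the Riemann weight up to the factor n/(n-1) = 1 + 1/(n-1).\<close>

lemma first_swap_prob_le_semicircle:
  assumes "1 \<le> k" "k \<le> n - 1"
  shows "first_swap_prob n k
    \<le> (1 + 1 / (real n - 1)) * (2 / real n * semicircle_density (2 * real k / real n - 1))"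
proof -
  define q where "q = sqrt (real k * (real n - real k))"
  have n: "real n > 1" "real k \<le> real n" using assms by auto
  have "\<bar>2 * real k / real n - 1\<bar> \<le> 1"
    using n by (simp add: abs_le_iff divide_simps)
  then have "semicircle_density (2 * real k / real n - 1) = 2 / pi * sqrt (1 - (2 * real k / real n - 1)\<^sup>2)"
    by (rule semicircle_density_eq_sqrt)
  also have "1 - (2 * real k / real n - 1)\<^sup>2 = (2 / real n)\<^sup>2 * (real k * (real n - real k))"
    using n by (simp add: field_simps power2_eq_square)
  also have "2 / pi * sqrt \<dots> = 4 / (pi * real n) * q"
    using n by (simp add: real_sqrt_mult q_def)
  finally have d: "semicircle_density (2 * real k / real n - 1) = 4 / (pi * real n) * q" .
  have "8 / (pi * real n * (real n - 1)) * q
    = (1 + 1 / (real n - 1)) * (2 / real n * semicircle_density (2 * real k / real n - 1))"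
    unfolding d using n by (simp add: divide_simps)
  then show ?thesis
    using first_swap_prob_le[OF assms] unfolding q_def by simp
qed

lemma (in prob_space) sum_prob_eq_1:
  assumes "X \<in> measurable M (count_space A)" "finite A"
  shows "(\<Sum>k\<in>A. \<P>(\<omega> in M. X \<omega> = k)) = 1"
  using expectation_finite_range[OF assms, of "\<lambda>_. 1"] prob_space by simp

section \<open>Lower bound: mass of the semicircle law away from the lattice\<close>

text \<open>Outside the intervals of radius t about the n+1 lattice points the distance is at least
  t. As the density is at most 2/pi \<le> 1, these intervals carry mass at most 2t each, and a union
  bound leaves enough mass outside them.\<close>

lemma semicircle_lattice_distance_ge:
  fixes n :: nat
  assumes n: "n \<ge> 2" and N: "prob_space N"
    and D: "distributed N lborel S (\<lambda>s. ennreal (semicircle_density s))"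
  shows "1 / (16 * real n) \<le> (\<integral>y. infdist (S y) ((\<lambda>k. 2 * real k / real n - 1) ` {..n}) \<partial>N)"
proof -
  interpret N: prob_space N by fact
  define x where "x = (\<lambda>k. 2 * real k / real n - 1)"
  \<comment> \<open>With this radius the intervals have total length (n+1)/(4n) \<le> 1/2, so mass
    at least 1/2 stays at distance at least t, and t/2 = 1/(16n).\<close>
  define t where "t = 1 / (8 * real n)"
  have t: "t > 0" using n by (simp add: t_def)
  have Sm [measurable]: "S \<in> borel_measurable N"
    using distributed_measurable[OF D] by simp
  define I where "I = (\<lambda>k. {x k - t..x k + t})"
  have ind_dist: "(\<integral>y. indicator (I k) (S y) \<partial>N) = (\<integral>s. semicircle_density s * indicator (I k) s \<partial>lborel)" for k
    using distributed_integral[OF D, of "indicator (I k)"] semicircle_density_nonneg by (simp add: I_def)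
  have PI: "(\<integral>y. indicator (I k) (S y) \<partial>N) \<le> 2 * t" for k
  proof -
    have "(\<integral>s. semicircle_density s * indicator (I k) s \<partial>lborel) \<le> (\<integral>s. indicator (I k) s \<partial>lborel)"
    proof (rule integral_mono_AE')
      show "integrable lborel (indicator (I k) :: real \<Rightarrow> real)"
        by (intro integrable_real_indicator) (auto simp: I_def emeasure_lborel_Icc_eq)
      have "2 / pi \<le> (1 :: real)" using pi_ge_two by simp
      then have "semicircle_density s \<le> 1" for s
        using semicircle_density_le[of s] by linarith
      then show "AE s in lborel. semicircle_density s * indicator (I k) s \<le> indicator (I k) s"
        by (auto simp: indicator_def)
      show "AE s in lborel. 0 \<le> (indicator (I k) s :: real)" by simp
    qed
    also have "\<dots> = 2 * t" using t by (simp add: I_def)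
    finally show ?thesis unfolding ind_dist .
  qed
  have int_ind: "integrable N (\<lambda>y. indicator (I k) (S y) :: real)" for k
    by (intro N.integrable_const_bound[of _ 1]) (auto simp: I_def indicator_def)
  have "1 / (16 * real n) \<le> t - t * (real (n + 1) * (2 * t))"
    using n by (simp add: t_def field_simps)
  also have "\<dots> \<le> t - t * (\<Sum>k\<le>n. \<integral>y. indicator (I k) (S y) \<partial>N)"
    using sum_mono[of "{..n}" "\<lambda>k. \<integral>y. indicator (I k) (S y) \<partial>N" "\<lambda>_. 2 * t"] PI t by simp
  also have "\<dots> = (\<integral>y. t - t * (\<Sum>k\<le>n. indicator (I k) (S y)) \<partial>N)"
    using int_ind N.prob_space by (simp add: Bochner_Integration.integral_sum)
  also have "\<dots> \<le> (\<integral>y. infdist (S y) (x ` {..n}) \<partial>N)"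
  proof (rule integral_mono)
    show "integrable N (\<lambda>y. t - t * (\<Sum>k\<le>n. indicator (I k) (S y)))"
      using int_ind by auto
    show "integrable N (\<lambda>y. infdist (S y) (x ` {..n}))"
      by (rule integral_semicircle_distributed(1)[OF D]) (intro continuous_intros)
    fix y
    \<comment> \<open>If \<open>S y\<close> lies in some interval, the indicator sum is at least 1
      and the left-hand side is at most 0; otherwise the left-hand side is t.\<close>
    show "t - t * (\<Sum>k\<le>n. indicator (I k) (S y)) \<le> infdist (S y) (x ` {..n})"
    proof (cases "\<exists>k\<le>n. S y \<in> I k")
      case True
      then obtain k where k: "k \<le> n" "S y \<in> I k" by blast
      have "indicator (I k) (S y) \<le> (\<Sum>k\<le>n. indicator (I k) (S y) :: real)"
        using k by (intro member_le_sum) auto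
      then have "t * 1 \<le> t * (\<Sum>k\<le>n. indicator (I k) (S y))"
        using k t by (intro mult_left_mono) auto
      then show ?thesis using infdist_nonneg[of "S y" "x ` {..n}"] by linarith
    next
      case False
      then have "(\<Sum>k\<le>n. indicator (I k) (S y) :: real) = 0"
        by (intro sum.neutral) auto
      moreover have "t \<le> infdist (S y) (x ` {..n})"
      proof -
        have "t \<le> dist (S y) (x k)" if "k \<le> n" for k
        proof -
          have "S y \<notin> I k" using False that by blast
          then show ?thesis unfolding I_def dist_real_def atLeastAtMost_iff by linarith
        qed
        then show ?thesis
          by (subst infdist_notempty) (auto intro!: cINF_greatest)
      qed
      ultimately show ?thesis by simp
    qed
  qed
  finally show ?thesis unfolding x_def .
qed

section \<open>Upper bound for a single 1-Lipschitz test function\<close>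

text \<open>The Riemann sum with weights \<open>r\<close> is the intermediate term: replacing the
  probabilities by \<open>r\<close> costs 13/n, and passing from the sum to the integral costs
  6/n.\<close>

lemma first_swap_semicircle_expectation_diff_le:
  fixes h :: "real \<Rightarrow> real"
  assumes n: "n \<ge> 2" and M: "prob_space M"
    and X: "X \<in> measurable M (count_space {1..n - 1})"
    and P: "\<And>k. 1 \<le> k \<Longrightarrow> k \<le> n - 1 \<Longrightarrow> \<P>(\<omega> in M. X \<omega> = k) = first_swap_prob n k"
    and N: "prob_space N"
    and D: "distributed N lborel S (\<lambda>s. ennreal (semicircle_density s))"
    and lip: "1-lipschitz_on UNIV h"
  shows "\<bar>(\<integral>\<omega>. h (2 * real (X \<omega>) / real n - 1) \<partial>M) - (\<integral>y. h (S y) \<partial>N)\<bar> \<le> 19 / real n"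
proof -
  interpret M: prob_space M by fact
  interpret N: prob_space N by fact
  define x where "x = (\<lambda>k. 2 * real k / real n - 1)"
  define A where "A = {1..n - 1}"
  define p where "p = first_swap_prob n"
  define r where "r = (\<lambda>k. 2 / real n * semicircle_density (x k))"
  \<comment> \<open>Centring at 0 makes the test function bounded by 1 on [-1,1]; the constant
    \<open>h 0\<close> contributes equally to both expectations and cancels.\<close>
  define g where "g = (\<lambda>s. h s - h 0)"
  have n0: "n > 0" "real n > 1" using n by auto
  have xA: "\<bar>x k\<bar> \<le> 1" if "k \<in> A" for k
    using that n0 by (auto simp: x_def A_def abs_le_iff divide_simps)
  \<comment> \<open>This rounds 8/pi up to 3.\<close>
  have pi: "8 / (pi * real n) * c \<le> 3 / real n * c" if "c \<ge> 0" for c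
    using pi_gt3 n0 that by (intro mult_right_mono) (auto simp: divide_simps)
  have PA: "\<P>(\<omega> in M. X \<omega> = k) = p k" if "k \<in> A" for k
    using P that by (simp add: A_def p_def)
  have sump: "sum p A = 1"
    using M.sum_prob_eq_1[OF X] PA by (simp add: A_def)
  have gl: "1-lipschitz_on UNIV g"
    using lip unfolding lipschitz_on_def g_def by (simp add: dist_real_def)
  have gb: "\<bar>g s\<bar> \<le> 1" if "\<bar>s\<bar> \<le> 1" for s
    using lipschitz_onD[OF gl, of s 0] that by (simp add: g_def dist_real_def)
  have hc: "continuous_on UNIV h"
    using lip by (rule lipschitz_on_continuous_on)
  have EM: "(\<integral>\<omega>. h (x (X \<omega>)) \<partial>M) = (\<Sum>k\<in>A. p k * g (x k)) + h 0"
  proof -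
    have "(\<integral>\<omega>. h (x (X \<omega>)) \<partial>M) = (\<Sum>k\<in>A. p k * h (x k))"
      using M.expectation_finite_range[OF X, of "\<lambda>k. h (x k)"] PA by (simp add: A_def)
    also have "\<dots> = (\<Sum>k\<in>A. p k * g (x k)) + h 0"
      using sump by (simp add: g_def right_diff_distrib sum_subtractf flip: sum_distrib_right)
    finally show ?thesis .
  qed
  have EN: "(\<integral>y. h (S y) \<partial>N) = integral {-1..1} (\<lambda>s. g s * semicircle_density s) + h 0"
  proof -
    have "(\<integral>y. g (S y) \<partial>N) = (\<integral>y. h (S y) \<partial>N) - h 0"
      unfolding g_def using integral_semicircle_distributed(1)[OF D hc] N.prob_space
      by (simp add: Bochner_Integration.integral_diff)
    then show ?thesis
      using integral_semicircle_distributed(2)[OF D lipschitz_on_continuous_on[OF gl]] by simp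
  qed
  \<comment> \<open>The Riemann estimate for the constant function 1, with L = 0 and B = 1.\<close>
  have sumr: "\<bar>sum r A - 1\<bar> \<le> 3 / real n"
  proof -
    have "integral {-1..1} (\<lambda>s. 1 * semicircle_density s) = 1"
      using integral_semicircle_distributed(2)[OF D, of "\<lambda>_. 1"] N.prob_space by simp
    then show ?thesis
      using semicircle_riemann_sum_error_le[of n 0 "\<lambda>_. 1" 1] n0 pi[of 1]
      by (simp add: r_def x_def A_def lipschitz_on_def)
  qed
  \<comment> \<open>Here L = B = 1, so the error is 3/n times 2.\<close>
  have riem: "\<bar>(\<Sum>k\<in>A. r k * g (x k)) - integral {-1..1} (\<lambda>s. g s * semicircle_density s)\<bar> \<le> 6 / real n"
    using semicircle_riemann_sum_error_le[OF n0(1) lipschitz_on_subset[OF gl], of 1] gb pi[of 2]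
    by (simp add: r_def x_def A_def mult_ac)
  have "\<bar>(\<Sum>k\<in>A. p k * g (x k)) - (\<Sum>k\<in>A. r k * g (x k))\<bar> \<le> (\<Sum>k\<in>A. \<bar>p k - r k\<bar>)"
  proof -
    have "\<bar>(\<Sum>k\<in>A. p k * g (x k)) - (\<Sum>k\<in>A. r k * g (x k))\<bar> \<le> (\<Sum>k\<in>A. \<bar>(p k - r k) * g (x k)\<bar>)"
      unfolding sum_subtractf[symmetric] left_diff_distrib[symmetric] by (rule sum_abs)
    also have "\<dots> \<le> (\<Sum>k\<in>A. \<bar>p k - r k\<bar>)"
      unfolding abs_mult by (intro sum_mono mult_left_le) (auto intro: gb xA)
    finally show ?thesis .
  qed
  also have "\<dots> \<le> (1 + 2 * (1 / (real n - 1))) * sum r A - sum p A"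
  proof (rule sum_abs_diff_le)
    fix k assume "k \<in> A"
    then show "p k \<le> (1 + 1 / (real n - 1)) * r k"
      unfolding p_def r_def x_def A_def by (intro first_swap_prob_le_semicircle) auto
    show "0 \<le> r k" by (simp add: r_def semicircle_density_nonneg)
  qed (use n0 in auto)
  also have "\<dots> \<le> (1 + 4 / real n) * (1 + 3 / real n) - 1"
  proof -
    \<comment> \<open>For n \<ge> 2 one has n - 1 \<ge> n/2.\<close>
    have "1 + 2 * (1 / (real n - 1)) \<le> 1 + 4 / real n"
      using n by (simp add: divide_simps) (simp add: algebra_simps)
    moreover have "sum r A \<le> 1 + 3 / real n" using sumr by linarith
    ultimately show ?thesis
      unfolding sump by (intro diff_right_mono mult_mono) (auto intro!: sum_nonneg simp: r_def semicircle_density_nonneg)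
  qed
  \<comment> \<open>The product expands to 7/n + 12/n^2, and 12/n^2 \<le> 6/n because n \<ge>
    2.\<close>
  also have "\<dots> \<le> 13 / real n"
    using n by (simp add: field_simps)
  finally have tv: "\<bar>(\<Sum>k\<in>A. p k * g (x k)) - (\<Sum>k\<in>A. r k * g (x k))\<bar> \<le> 13 / real n" .
  have "\<bar>(\<integral>\<omega>. h (x (X \<omega>)) \<partial>M) - (\<integral>y. h (S y) \<partial>N)\<bar> \<le> 13 / real n + 6 / real n"
    unfolding EM EN using tv riem by linarith
  then show ?thesis by (simp add: x_def)
qed

section \<open>Both bounds through the supremum over test functions\<close>

theorem theorem1p1:
  fixes n :: nat
    and M :: "'a measure" and X :: "'a \<Rightarrow> nat"
    and N :: "'b measure" and S :: "'b \<Rightarrow> real"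
  assumes "n \<ge> 2"
    and "prob_space M"
    and "X \<in> measurable M (count_space {1..n - 1})"
    and "\<And>k. 1 \<le> k \<Longrightarrow> k \<le> n - 1 \<Longrightarrow> \<P>(\<omega> in M. X \<omega> = k) = first_swap_prob n k"
    and "prob_space N"
    and "distributed N lborel S (\<lambda>s. ennreal (semicircle_density s))"
  shows "ereal (1 / (16 * real n)) \<le> wasserstein_dist M (\<lambda>\<omega>. 2 * real (X \<omega>) / real n - 1) N S
    \<and> wasserstein_dist M (\<lambda>\<omega>. 2 * real (X \<omega>) / real n - 1) N S \<le> ereal (59 / real n)"
proof
  let ?U = "\<lambda>\<omega>. 2 * real (X \<omega>) / real n - 1"
  let ?L = "(\<lambda>k. 2 * real k / real n - 1) ` {..n}"
  have "1-lipschitz_on UNIV (\<lambda>s. infdist s ?L)"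
    using infdist_triangle_abs[of _ ?L] by (simp add: lipschitz_on_def dist_real_def)
  then have "ereal \<bar>(\<integral>\<omega>. infdist (?U \<omega>) ?L \<partial>M) - (\<integral>y. infdist (S y) ?L \<partial>N)\<bar> \<le> wasserstein_dist M ?U N S"
    unfolding wasserstein_dist_def by (intro SUP_upper) auto
  moreover have "(\<integral>\<omega>. infdist (?U \<omega>) ?L \<partial>M) = (\<integral>\<omega>. 0 \<partial>M)"
  proof (rule Bochner_Integration.integral_cong[OF refl])
    fix \<omega> assume "\<omega> \<in> space M"
    then have "X \<omega> \<le> n" using measurable_space[OF assms(3)] by fastforce
    then show "infdist (?U \<omega>) ?L = 0" by (intro infdist_zero) auto
  qed
  moreover have "1 / (16 * real n) \<le> (\<integral>y. infdist (S y) ?L \<partial>N)"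
    using assms by (intro semicircle_lattice_distance_ge)
  ultimately show "ereal (1 / (16 * real n)) \<le> wasserstein_dist M ?U N S"
    by (auto intro: order.trans[rotated])
next
  show "wasserstein_dist M (\<lambda>\<omega>. 2 * real (X \<omega>) / real n - 1) N S \<le> ereal (59 / real n)"
    unfolding wasserstein_dist_def
  proof (rule SUP_least)
    fix h :: "real \<Rightarrow> real" assume "h \<in> {h. 1-lipschitz_on UNIV h}"
    then have "\<bar>(\<integral>\<omega>. h (2 * real (X \<omega>) / real n - 1) \<partial>M) - (\<integral>y. h (S y) \<partial>N)\<bar> \<le> 19 / real n"
      using assms by (intro first_swap_semicircle_expectation_diff_le) auto
    \<comment> \<open>The estimate 19/n is already sharper than the bound claimed.\<close>
    also have "\<dots> \<le> 59 / real n" by (simp add: divide_right_mono)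
    finally show "ereal \<bar>(\<integral>\<omega>. h (2 * real (X \<omega>) / real n - 1) \<partial>M) - (\<integral>y. h (S y) \<partial>N)\<bar> \<le> ereal (59 / real n)"
      by simp
  qed
qed

end
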